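(* Let $N\ge1$, $1\le p<\infty$. There exists a constant $\mathcal{W}_{N,p}>0$, depending only on $N$ and $p$, such that for every $0<s<1$, every $x_0\in\mathbb{R}^N$, every $r>0$ and every $u\in C^\infty_0(\mathbb{R}^N)$ $$\|u-\mathrm{av}(u;B_r(x_0))\|^p_{L^p(B_r(x_0))}\le\mathcal{W}_{N,p}\,s\,(1-s)\,r^{s\,p}\iint_{B_r(x_0)\times\mathbb{R}^N}\frac{|u(x)-u(y)|^p}{|x-y|^{N+s\,p}}\,dx\,dy.$$
   Context: $B_r(x_0)$ is the open ball of centre $x_0$ and radius $r$ in $\mathbb{R}^N$; $\mathrm{av}(u;E)=\frac{1}{|E|}\int_Eu\,dx$ for a measurable set $E$ of finite positive measure; $C^\infty_0(\mathbb{R}^N)$ is the space of smooth compactly supported functions. *)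

theory Defs
  imports "HOL-Analysis.Analysis"
begin

text \<open>\<open>C_diff k f\<close>: \<open>f\<close> is of class \<open>C\<^sup>k\<close> on the whole space, i.e. all iterated directional
  derivatives of order at most \<open>k\<close> exist (in the Frechet sense) and are continuous.\<close>

primrec C_diff :: "nat \<Rightarrow> (real^'n \<Rightarrow> real) \<Rightarrow> bool" where
  "C_diff 0 f \<longleftrightarrow> continuous_on UNIV f"
| "C_diff (Suc k) f \<longleftrightarrow>
     (\<forall>x. f differentiable (at x)) \<and> (\<forall>v. C_diff k (\<lambda>x. frechet_derivative f (at x) v))"

definition smooth_compact_support :: "(real^'n \<Rightarrow> real) set" where
  "smooth_compact_support = {u. (\<forall>k. C_diff k u) \<and> compact (closure {x. u x \<noteq> 0})}"

definition av :: "(real^'n \<Rightarrow> real) \<Rightarrow> (real^'n) set \<Rightarrow> real" where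
  "av u E = 1 / measure lebesgue E * (LINT x:E|lebesgue. u x)"

text \<open>Powers \<open>a\<^sup>q\<close> with real exponent \<open>q > 0\<close> on \<open>[0, \<infinity>]\<close>, so that norms and energies below
  take the value \<open>\<infinity>\<close> when the integral diverges.\<close>

definition ennpowr :: "ennreal \<Rightarrow> real \<Rightarrow> ennreal" where
  "ennpowr a q = (if a = \<infinity> then \<infinity> else ennreal (enn2real a powr q))"

definition Lp_norm :: "real \<Rightarrow> (real^'n) set \<Rightarrow> (real^'n \<Rightarrow> real) \<Rightarrow> ennreal" where
  "Lp_norm p E f = ennpowr (\<integral>\<^sup>+x\<in>E. ennreal (\<bar>f x\<bar> powr p) \<partial>lebesgue) (1 / p)"

text \<open>The Gagliardo double integral over \<open>A \<subseteq> \<real>\<^sup>N \<times> \<real>\<^sup>N\<close>, with respect to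
  \<open>2N\<close>-dimensional Lebesgue measure. The integrand is \<open>0\<close> on the (null) diagonal, as \<open>0 / 0 = 0\<close>.\<close>

definition gagliardo_energy ::
    "real \<Rightarrow> real \<Rightarrow> ((real^'n) \<times> (real^'n)) set \<Rightarrow> (real^'n \<Rightarrow> real) \<Rightarrow> ennreal" where
  "gagliardo_energy s p A u =
     (\<integral>\<^sup>+z\<in>A. ennreal (\<bar>u (fst z) - u (snd z)\<bar> powr p /
                       norm (fst z - snd z) powr (real CARD('n) + s * p)) \<partial>lebesgue)"

end

theory Submission
  imports Defs
begin

text \<open>
  Write \<open>B = ball x0 r\<close>, let \<open>A\<close> be the integral of \<open>\<bar>u - av u B\<bar>\<^sup>p\<close> over \<open>B\<close>, let \<open>E\<close> be the
  double integral on the right-hand side, and for \<open>t > 0\<close> let \<open>J(t)\<close> be the integral of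
  \<open>\<bar>u x - u y\<bar>\<^sup>p\<close> over the pairs in \<open>B \<times> \<real>\<^sup>N\<close> at distance at most \<open>t\<close>.
  For fixed \<open>x\<close> and \<open>y\<close>, the sum of \<open>t\<close> to the power \<open>-(N + s p)\<close> over the dyadic scales
  \<open>t \<ge> dist x y\<close> is a geometric sum dominated by its smallest scale, hence at most twice the kernel.
  So \<open>2 E\<close> bounds the sum of \<open>t\<close> to the power \<open>-(N + s p)\<close> times \<open>J(t)\<close> over any family
  of distinct dyadic multiples \<open>t\<close> of \<open>r\<close> (\<open>suminf_increment_energy_le\<close>). What remains is to bound \<open>J(t)\<close>
  from below by a multiple of \<open>A\<close>, and the two factors \<open>s\<close> and \<open>1 - s\<close> come from the two ends of the
  scale range.

  Large scales \<open>t = 2\<^sup>n r\<close>, \<open>n \<ge> 1\<close>. Up to the factor \<open>2\<^sup>p\<close> the average is the best constant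
  approximating \<open>u\<close> on \<open>B\<close>, so each single \<open>y\<close> contributes at least \<open>2\<close> to the power \<open>-p\<close> times
  \<open>A\<close>, and \<open>J(t)\<close> is at least of the order of \<open>t\<^sup>N A\<close>. The terms of the sum decay like the powers of
  \<open>q\<close>, the power of \<open>2\<close> with exponent \<open>-s p\<close>, so the sum is of order \<open>1 / (s p)\<close>, which gives
  \<open>A \<le> C s r\<^sup>s\<^sup>p E\<close>.

  Small scales \<open>t = 2 r / 2\<^sup>n\<close>. Splitting an increment at the midpoint, which stays in the convex set
  \<open>B\<close>, shows that halving \<open>t\<close> decreases the part of \<open>J(t)\<close> over \<open>B \<times> B\<close> by a factor of at most
  \<open>2\<^sup>p\<^sup>+\<^sup>N\<close>. At \<open>t = 2 r\<close> that part is bounded below as before. Now the terms decay like the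
  powers of \<open>2\<close> with exponent \<open>-(1 - s) p\<close>, and the sum is of order \<open>1 / ((1 - s) p)\<close>, so
  \<open>A \<le> C (1 - s) r\<^sup>s\<^sup>p E\<close> with the same \<open>C\<close>.

  The two bounds combine because \<open>min s (1 - s) \<le> 2 s (1 - s)\<close>.
\<close>

section \<open>Convexity of the power function\<close>

text \<open>
  This convexity bound is the weighted inequality between the arithmetic and geometric means of
  \<open>t\<^sup>p\<close> and \<open>m\<^sup>p\<close> with weights \<open>1 / p\<close> and \<open>1 - 1 / p\<close>. Integrating it gives Jensen's inequality,
  adding two instances gives the sharp inequality for sums below.
\<close>
lemma powr_ge_tangent:
  fixes p m t :: real
  assumes "1 \<le> p" "0 \<le> m" "0 \<le> t"
  shows "m powr p + p * m powr (p - 1) * (t - m) \<le> t powr p"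
proof (cases "m = 0 \<or> t = 0")
  case True
  have "m powr p = m powr (p - 1) * m" if "m > 0"
    using that by (simp flip: powr_mult_base add: powr_diff)
  then show ?thesis
    using True assms by (cases "m = 0") (auto simp: algebra_simps mult_le_cancel_right1)
next
  case False
  then have pos: "m > 0" "t > 0" using assms by auto
  have "(t powr p) powr (1/p) * (m powr p) powr (1 - 1/p) \<le> 1/p * t powr p + (1 - 1/p) * m powr p"
    by (rule Youngs_inequality_0) (use assms pos in auto)
  moreover have "p * (1 - 1/p) = p - 1" using assms by (simp add: field_simps)
  ultimately have "t * m powr (p - 1) \<le> 1/p * t powr p + (1 - 1/p) * m powr p"
    using assms pos by (simp add: powr_powr)
  then have "p * (t * m powr (p - 1)) \<le> p * (1/p * t powr p + (1 - 1/p) * m powr p)"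
    using assms by (intro mult_left_mono) auto
  also have "\<dots> = t powr p + (p - 1) * m powr p"
    using assms by (simp add: field_simps)
  finally have "p * (t * m powr (p - 1)) \<le> t powr p + (p - 1) * m powr p" .
  moreover have "m powr p = m powr (p - 1) * m"
    using pos by (simp add: powr_diff)
  ultimately show ?thesis by (simp add: algebra_simps)
qed

text \<open>
  The constant must be \<open>2\<close> to the power \<open>p - 1\<close>: it makes bisecting an increment cost exactly
  \<open>2\<^sup>p\<close>, and a larger constant would destroy the decay rate of the small scales.
\<close>
lemma powr_add_le:
  fixes a b p :: real
  assumes "1 \<le> p" "0 \<le> a" "0 \<le> b"
  shows "(a + b) powr p \<le> 2 powr (p - 1) * (a powr p + b powr p)"
proof -
  define m where "m = (a + b) / 2"
  have m: "0 \<le> m" using assms by (simp add: m_def)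
  have "m powr p + p * m powr (p - 1) * (a - m) + (m powr p + p * m powr (p - 1) * (b - m))
      \<le> a powr p + b powr p"
    using assms m by (intro add_mono powr_ge_tangent) auto
  moreover have "p * m powr (p - 1) * (a - m) + p * m powr (p - 1) * (b - m) = 0"
    by (simp add: m_def field_simps)
  ultimately have "2 * m powr p \<le> a powr p + b powr p" by linarith
  moreover have "(a + b) powr p = 2 powr (p - 1) * (2 * m powr p)"
  proof -
    have "(a + b) powr p = (2 * m) powr p" unfolding m_def by (simp del: distrib_left_numeral)
    also have "\<dots> = 2 powr p * m powr p" using m by (simp add: powr_mult)
    also have "2 powr p = 2 powr (p - 1) * (2::real)" by (simp add: powr_diff)
    finally show ?thesis by simp
  qed
  ultimately show ?thesis by (simp add: mult_left_mono)
qed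

section \<open>The average as an almost optimal constant\<close>

text \<open>
  By Jensen's inequality the mean differs from \<open>c\<close> by no more than the average size of \<open>f - c\<close> in
  \<open>L\<^sup>p\<close>, so replacing \<open>c\<close> by the mean at most doubles the \<open>L\<^sup>p\<close> distance.
\<close>
lemma (in finite_measure) nn_integral_powr_diff_mean_le:
  fixes f :: "'a \<Rightarrow> real"
  assumes p: "1 \<le> p" and f: "integrable M f" and V: "0 < measure M (space M)"
  shows "(\<integral>\<^sup>+x. ennreal (\<bar>f x - (1 / measure M (space M)) * integral\<^sup>L M f\<bar> powr p) \<partial>M)
       \<le> ennreal (2 powr p) * (\<integral>\<^sup>+x. ennreal (\<bar>f x - c\<bar> powr p) \<partial>M)"
proof (cases "(\<integral>\<^sup>+x. ennreal (\<bar>f x - c\<bar> powr p) \<partial>M) = \<infinity>")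
  case True
  then show ?thesis by (simp add: ennreal_mult_top)
next
  case False
  define V where "V = measure M (space M)"
  define g where "g = (\<lambda>x. \<bar>f x - c\<bar>)"
  define m where "m = (1 / V) * integral\<^sup>L M g"
  define a where "a = (1 / V) * integral\<^sup>L M f"
  have V0: "V > 0" using V by (simp add: V_def)
  have [measurable]: "f \<in> borel_measurable M" using f by auto
  have g: "integrable M g" unfolding g_def using f by auto
  have gp: "integrable M (\<lambda>x. g x powr p)"
    by (rule integrableI_bounded) (use False in \<open>auto simp: g_def top.not_eq_extremum\<close>)
  have m0: "0 \<le> m" using V0 by (simp add: m_def g_def)
  have "\<bar>a - c\<bar> = \<bar>(1 / V) * (\<integral>x. f x - c \<partial>M)\<bar>"
    using V0 f by (simp add: a_def V_def field_simps)
  also have "\<dots> \<le> m"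
    using V0 by (simp add: m_def g_def abs_mult divide_right_mono)
  finally have ac: "\<bar>a - c\<bar> \<le> m" .
  have "(\<integral>x. m powr p + p * m powr (p - 1) * (g x - m) \<partial>M) \<le> (\<integral>x. g x powr p \<partial>M)"
    by (intro integral_mono gp powr_ge_tangent)
       (use g m0 p in \<open>auto simp: g_def\<close>)
  also have "(\<integral>x. m powr p + p * m powr (p - 1) * (g x - m) \<partial>M)
      = V * m powr p + p * m powr (p - 1) * (integral\<^sup>L M g - V * m)"
    using g by (simp add: V_def)
  also have "\<dots> = V * m powr p" using V0 by (simp add: m_def)
  finally have jensen: "V * m powr p \<le> (\<integral>x. g x powr p \<partial>M)" .
  have "(\<integral>\<^sup>+x. ennreal (\<bar>f x - a\<bar> powr p) \<partial>M)
      \<le> (\<integral>\<^sup>+x. ennreal (2 powr (p - 1) * (g x powr p + m powr p)) \<partial>M)"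
  proof (intro nn_integral_mono ennreal_leI)
    fix x
    have "\<bar>f x - a\<bar> powr p \<le> (g x + m) powr p"
      using ac p by (intro powr_mono2) (auto simp: g_def)
    also have "\<dots> \<le> 2 powr (p - 1) * (g x powr p + m powr p)"
      using p m0 by (intro powr_add_le) (auto simp: g_def)
    finally show "\<bar>f x - a\<bar> powr p \<le> 2 powr (p - 1) * (g x powr p + m powr p)" .
  qed
  also have "\<dots> = ennreal (\<integral>x. 2 powr (p - 1) * (g x powr p + m powr p) \<partial>M)"
    by (intro nn_integral_eq_integral) (use gp in auto)
  also have "(\<integral>x. 2 powr (p - 1) * (g x powr p + m powr p) \<partial>M)
      = 2 powr (p - 1) * ((\<integral>x. g x powr p \<partial>M) + V * m powr p)"
    using gp by (simp add: V_def)
  also have "ennreal \<dots> \<le> ennreal (2 powr p * (\<integral>x. g x powr p \<partial>M))"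
    using jensen by (intro ennreal_leI) (simp add: powr_diff field_simps)
  also have "\<dots> = ennreal (2 powr p) * (\<integral>\<^sup>+x. ennreal (g x powr p) \<partial>M)"
    using gp by (subst nn_integral_eq_integral) (auto simp: ennreal_mult)
  finally show ?thesis by (simp add: a_def V_def g_def)
qed

section \<open>Energy of increments up to a given length\<close>

text \<open>
  Both domains are parameters because bisection needs \<open>y\<close> to stay in the ball, while the energy to be
  compared with lets \<open>y\<close> range over the whole space.
\<close>
definition increment_energy ::
    "real \<Rightarrow> 'a::euclidean_space set \<Rightarrow> 'a set \<Rightarrow> real \<Rightarrow> ('a \<Rightarrow> real) \<Rightarrow> ennreal" where
  "increment_energy p A B t u =
     (\<integral>\<^sup>+x\<in>A. (\<integral>\<^sup>+y\<in>B. (if dist x y \<le> t then ennreal (\<bar>u x - u y\<bar> powr p) else 0) \<partial>lborel) \<partial>lborel)"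

lemma increment_energy_mono:
  assumes "A \<subseteq> A'" "B \<subseteq> B'"
  shows "increment_energy p A B t u \<le> increment_energy p A' B' t u"
  unfolding increment_energy_def
  by (intro nn_integral_mono mult_mono) (use assms in \<open>auto simp: indicator_def\<close>)

text \<open>
  The scales in \<open>F\<close> are distinct powers of two times \<open>r\<close>, so the sum is at most the geometric series
  starting at the smallest scale. Its ratio is at most \<open>1 / 2\<close> as \<open>a \<ge> 1\<close>, which makes the constant
  \<open>2\<close> independent of \<open>a\<close>.
\<close>
lemma sum_dyadic_powr_le:
  fixes r d a :: real and F :: "int set"
  assumes "finite F" "0 < d" "0 < r" "1 \<le> a"
    and le: "\<And>j. j \<in> F \<Longrightarrow> d \<le> r * 2 powr j"
  shows "(\<Sum>j\<in>F. (r * 2 powr j) powr (-a)) \<le> 2 * d powr (-a)"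
proof (cases "F = {}")
  case False
  define m where "m = Min F"
  define q :: real where "q = 2 powr (-a)"
  have q: "0 \<le> q" "q \<le> 1/2"
  proof -
    have "2 powr (-a) \<le> 2 powr (-1::real)" using assms by (intro powr_mono) auto
    then show "q \<le> 1/2" by (simp add: q_def powr_minus_divide)
  qed (simp add: q_def)
  have mF: "m \<in> F" and min: "\<And>j. j \<in> F \<Longrightarrow> m \<le> j"
    using False assms by (auto simp: m_def)
  have inj: "inj_on (\<lambda>j. nat (j - m)) F"
    proof (rule inj_onI)
    fix i j assume "i \<in> F" "j \<in> F" "nat (i - m) = nat (j - m)"
    with min[of i] min[of j] show "i = j" by linarith
  qed
  have "(\<Sum>j\<in>F. (r * 2 powr j) powr (-a)) = (\<Sum>j\<in>F. (r * 2 powr m) powr (-a) * q ^ nat (j - m))"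
  proof (intro sum.cong refl)
    fix j assume "j \<in> F"
    then have "m \<le> j" by (rule min)
    then have "real_of_int j = real_of_int m + real (nat (j - m))" by simp
    then have "(2::real) powr j = 2 powr m * 2 powr (real (nat (j - m)))"
      by (simp only: powr_add)
    moreover have "(2 powr (real (nat (j - m)))) powr (-a) = q ^ nat (j - m)"
      unfolding q_def by (simp only: powr_realpow[symmetric] powr_gt_zero powr_powr mult.commute)
    ultimately show "(r * 2 powr j) powr (-a) = (r * 2 powr m) powr (-a) * q ^ nat (j - m)"
      using assms by (simp add: powr_mult mult.assoc)
  qed
  also have "\<dots> = (r * 2 powr m) powr (-a) * (\<Sum>i\<in>(\<lambda>j. nat (j - m)) ` F. q ^ i)"
    using inj by (simp add: sum.reindex sum_distrib_left)
  also have "\<dots> \<le> d powr (-a) * 2"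
  proof (intro mult_mono)
    show "(r * 2 powr m) powr (-a) \<le> d powr (-a)"
      using assms le[OF mF] by (intro powr_mono2') auto
    have "(\<Sum>i\<in>(\<lambda>j. nat (j - m)) ` F. q ^ i) \<le> (\<Sum>i. q ^ i)"
      using assms(1) q by (intro sum_le_suminf summable_geometric) auto
    also have "\<dots> = 1 / (1 - q)" using q by (intro suminf_geometric) auto
    also have "\<dots> \<le> 2" using q by (simp add: field_simps)
    finally show "(\<Sum>i\<in>(\<lambda>j. nat (j - m)) ` F. q ^ i) \<le> 2" .
  qed (use q in \<open>auto intro!: sum_nonneg\<close>)
  finally show ?thesis by simp
qed (use assms in auto)

text \<open>
  The preceding bound on dyadic sums, integrated in \<open>x\<close> and \<open>y\<close>. The sequence \<open>k\<close> selects which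
  dyadic scales are used; it will run towards either large or small scales.
\<close>
lemma suminf_increment_energy_le:
  fixes u :: "'a::euclidean_space \<Rightarrow> real" and k :: "nat \<Rightarrow> int"
  assumes [measurable]: "u \<in> borel_measurable borel" "S \<in> sets borel"
    and r: "0 < r" and a: "1 \<le> a" and k: "inj k"
  shows "(\<Sum>n. ennreal ((r * 2 powr k n) powr (-a)) * increment_energy p S UNIV (r * 2 powr k n) u)
    \<le> 2 * (\<integral>\<^sup>+x\<in>S. (\<integral>\<^sup>+y. ennreal (\<bar>u x - u y\<bar> powr p / norm (x - y) powr a) \<partial>lborel) \<partial>lborel)"
proof -
  define w where "w = (\<lambda>n. (r * 2 powr k n) powr (-a))"
  define t where "t = (\<lambda>n. r * 2 powr k n)"
  define h where "h = (\<lambda>n x y. if dist x y \<le> t n then ennreal (\<bar>u x - u y\<bar> powr p) else 0)"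
  have [measurable]: "case_prod (h n) \<in> borel_measurable (lborel \<Otimes>\<^sub>M lborel)" for n
    unfolding h_def by measurable
  have pointwise: "(\<Sum>n. ennreal (w n) * h n x y)
      \<le> 2 * ennreal (\<bar>u x - u y\<bar> powr p / norm (x - y) powr a)" for x y
  proof (cases "x = y")
    case False
    show ?thesis
    proof (intro suminf_le_const summableI)
      fix n
      define F where "F = {i\<in>{..<n}. dist x y \<le> t i}"
      have "(\<Sum>i<n. ennreal (w i) * h i x y) = (\<Sum>i\<in>F. ennreal (w i * \<bar>u x - u y\<bar> powr p))"
        unfolding F_def by (subst sum.inter_filter) (auto simp: h_def w_def ennreal_mult intro!: sum.cong)
      also have "\<dots> = ennreal ((\<Sum>i\<in>F. w i) * \<bar>u x - u y\<bar> powr p)"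
        by (simp add: w_def sum_ennreal sum_distrib_right)
      also have "\<dots> \<le> ennreal (2 * dist x y powr (-a) * \<bar>u x - u y\<bar> powr p)"
      proof (intro ennreal_leI mult_right_mono)
        have "(\<Sum>i\<in>F. w i) = (\<Sum>j\<in>k ` F. (r * 2 powr j) powr (-a))"
          using inj_on_subset[OF k] by (subst sum.reindex) (auto simp: w_def)
        also have "\<dots> \<le> 2 * dist x y powr (-a)"
          by (rule sum_dyadic_powr_le) (use False r a in \<open>auto simp: F_def t_def\<close>)
        finally show "(\<Sum>i\<in>F. w i) \<le> 2 * dist x y powr (-a)" .
      qed auto
      also have "\<dots> = 2 * ennreal (\<bar>u x - u y\<bar> powr p / norm (x - y) powr a)"
        by (simp add: dist_norm powr_minus_divide flip: ennreal_numeral ennreal_mult)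
      finally show "(\<Sum>i<n. ennreal (w i) * h i x y)
          \<le> 2 * ennreal (\<bar>u x - u y\<bar> powr p / norm (x - y) powr a)" .
    qed
  next
    case True
    then have "h n x y = 0" for n by (simp add: h_def)
    then show ?thesis by simp
  qed
  have "(\<Sum>n. ennreal (w n) * increment_energy p S UNIV (t n) u)
      = (\<Sum>n. \<integral>\<^sup>+x\<in>S. (\<integral>\<^sup>+y. ennreal (w n) * h n x y \<partial>lborel) \<partial>lborel)"
  proof -
    have "increment_energy p S UNIV (t n) u = (\<integral>\<^sup>+x\<in>S. (\<integral>\<^sup>+y. h n x y \<partial>lborel) \<partial>lborel)" for n
      by (simp add: increment_energy_def h_def)
    then show ?thesis by (simp add: nn_integral_cmult mult.assoc)
  qed
  also have "\<dots> = (\<integral>\<^sup>+x. (\<Sum>n. (\<integral>\<^sup>+y. ennreal (w n) * h n x y \<partial>lborel) * indicator S x) \<partial>lborel)"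
    by (subst nn_integral_suminf) auto
  also have "\<dots> = (\<integral>\<^sup>+x\<in>S. (\<integral>\<^sup>+y. (\<Sum>n. ennreal (w n) * h n x y) \<partial>lborel) \<partial>lborel)"
    by (simp add: nn_integral_suminf)
  also have "\<dots> \<le> (\<integral>\<^sup>+x\<in>S. (\<integral>\<^sup>+y. 2 * ennreal (\<bar>u x - u y\<bar> powr p / norm (x - y) powr a) \<partial>lborel) \<partial>lborel)"
    by (intro nn_integral_mono mult_right_mono pointwise) auto
  also have "\<dots> = 2 * (\<integral>\<^sup>+x\<in>S. (\<integral>\<^sup>+y. ennreal (\<bar>u x - u y\<bar> powr p / norm (x - y) powr a) \<partial>lborel) \<partial>lborel)"
    by (simp add: nn_integral_cmult mult.assoc)
  finally show ?thesis by (simp add: w_def t_def)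
qed

text \<open>
  The small factors \<open>s\<close> and \<open>1 - s\<close> arise here: a geometric series whose ratio is \<open>2\<close> to the
  power \<open>-x\<close> sums to at least \<open>1 / x\<close>.
\<close>
lemma le_if_geometric_minorant:
  fixes A E :: ennreal and F :: "nat \<Rightarrow> ennreal"
  assumes "0 < x" "0 < C"
    and F: "\<And>n. ennreal (C * (2 powr (-x)) ^ n) * A \<le> F n"
    and E: "suminf F \<le> 2 * E"
  shows "A \<le> ennreal (2 * x / C) * E"
proof -
  define q :: real where "q = 2 powr (-x)"
  have q: "0 < q" "q < 1" using assms powr_less_mono[of "-x" 0 2] by (auto simp: q_def)
  have "1 - x \<le> q"
  proof -
    have "x * ln 2 \<le> x" using assms ln_le_minus_one[of "2::real"] by simp
    moreover have "1 + (- x * ln 2) \<le> exp (- x * ln 2)" by (rule exp_ge_add_one_self)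
    ultimately show ?thesis by (simp add: q_def powr_def)
  qed
  then have "1 / x \<le> 1 / (1 - q)" using assms(1) q by (intro divide_left_mono) auto
  then have "C * (1 / x) \<le> C * (1 / (1 - q))" using assms(2) by (intro mult_left_mono) auto
  then have "C / x \<le> C * (1 / (1 - q))" by simp
  then have "ennreal (C / x) * A \<le> ennreal (C * (1 / (1 - q))) * A"
    by (intro mult_right_mono ennreal_leI) auto
  also have "ennreal (C * (1 / (1 - q))) = (\<Sum>n. ennreal (C * q ^ n))"
    using q assms by (intro suminf_ennreal_eq[symmetric] sums_mult geometric_sums) auto
  also have "\<dots> * A = (\<Sum>n. ennreal (C * q ^ n) * A)" by simp
  also have "\<dots> \<le> suminf F" using F by (intro suminf_le) (auto simp: q_def)
  also have "\<dots> \<le> 2 * E" by (rule E)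
  finally have "ennreal (x / C) * (ennreal (C / x) * A) \<le> ennreal (x / C) * (2 * E)"
    by (intro mult_left_mono) auto
  moreover have "ennreal (x / C) * (ennreal (C / x) * A) = A"
    using assms by (simp flip: mult.assoc ennreal_mult)
  moreover have "ennreal (x / C) * (2 * E) = ennreal (2 * x / C) * E"
  proof -
    have "ennreal (2 * x / C) = 2 * ennreal (x / C)"
      using assms ennreal_mult'[of 2 "x / C"] by simp
    then show ?thesis by (simp add: mult_ac)
  qed
  ultimately show ?thesis by simp
qed

section \<open>Small scales\<close>

lemma nn_integral_lborel_homothety:
  fixes f :: "'a::euclidean_space \<Rightarrow> ennreal"
  assumes [measurable]: "f \<in> borel_measurable borel" and c: "c \<noteq> 0"
  shows "(\<integral>\<^sup>+x. f x \<partial>lborel) = ennreal (\<bar>c\<bar> ^ DIM('a)) * (\<integral>\<^sup>+x. f (b + c *\<^sub>R x) \<partial>lborel)"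
  using c by (subst lborel_affine[of c b])
    (simp_all add: nn_integral_density nn_integral_distr nn_integral_cmult)

text \<open>
  Let \<open>m\<close> be the midpoint of \<open>x\<close> and \<open>y\<close>. Convexity of the power bounds \<open>\<bar>u x - u y\<bar>\<^sup>p\<close> by the
  increments from \<open>x\<close> to \<open>m\<close> and from \<open>y\<close> to \<open>m\<close>, which contribute equally by symmetry. For
  fixed \<open>x\<close> the substitution of \<open>m\<close> for \<open>y\<close> costs the Jacobian \<open>2\<^sup>N\<close>, and \<open>m\<close> lies in \<open>B\<close> at
  half the distance.
\<close>
lemma increment_energy_double_le:
  fixes u :: "'a::euclidean_space \<Rightarrow> real"
  assumes [measurable]: "u \<in> borel_measurable borel" "B \<in> sets borel"
    and B: "convex B" and p: "1 \<le> p"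
  shows "increment_energy p B B (2 * t) u \<le> ennreal (2 powr (p + DIM('a))) * increment_energy p B B t u"
proof -
  define c where "c = ennreal (2 powr (p - 1))"
  define h where "h = (\<lambda>x y. if dist x y \<le> 2 * t \<and> x \<in> B \<and> y \<in> B
      then ennreal (\<bar>u x - u ((1/2) *\<^sub>R x + (1/2) *\<^sub>R y)\<bar> powr p) else 0)"
  have [measurable]: "case_prod h \<in> borel_measurable (lborel \<Otimes>\<^sub>M lborel)"
    unfolding h_def by measurable
  have "increment_energy p B B (2 * t) u = (\<integral>\<^sup>+x. \<integral>\<^sup>+y.
      (if dist x y \<le> 2 * t \<and> x \<in> B \<and> y \<in> B then ennreal (\<bar>u x - u y\<bar> powr p) else 0) \<partial>lborel \<partial>lborel)"
    unfolding increment_energy_def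
    by (intro nn_integral_cong) (auto simp: indicator_def intro!: nn_integral_cong)
  also have "\<dots> \<le> (\<integral>\<^sup>+x. \<integral>\<^sup>+y. c * (h x y + h y x) \<partial>lborel \<partial>lborel)"
  proof (intro nn_integral_mono)
    fix x y :: 'a
    define m where "m = (1/2) *\<^sub>R x + (1/2) *\<^sub>R y"
    have "\<bar>u x - u y\<bar> powr p \<le> (\<bar>u x - u m\<bar> + \<bar>u y - u m\<bar>) powr p"
      using p by (intro powr_mono2) auto
    also have "\<dots> \<le> 2 powr (p - 1) * (\<bar>u x - u m\<bar> powr p + \<bar>u y - u m\<bar> powr p)"
      using p by (intro powr_add_le) auto
    finally have "ennreal (\<bar>u x - u y\<bar> powr p)
        \<le> c * (ennreal (\<bar>u x - u m\<bar> powr p) + ennreal (\<bar>u y - u m\<bar> powr p))"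
      by (simp add: c_def flip: ennreal_plus ennreal_mult)
    then show "(if dist x y \<le> 2 * t \<and> x \<in> B \<and> y \<in> B then ennreal (\<bar>u x - u y\<bar> powr p) else 0)
        \<le> c * (h x y + h y x)"
      by (auto simp: h_def m_def dist_commute add.commute)
  qed
  also have "\<dots> = c * ((\<integral>\<^sup>+x. \<integral>\<^sup>+y. h x y \<partial>lborel \<partial>lborel) + (\<integral>\<^sup>+x. \<integral>\<^sup>+y. h y x \<partial>lborel \<partial>lborel))"
    by (simp add: nn_integral_cmult nn_integral_add)
  also have "(\<integral>\<^sup>+x. \<integral>\<^sup>+y. h y x \<partial>lborel \<partial>lborel) = (\<integral>\<^sup>+x. \<integral>\<^sup>+y. h x y \<partial>lborel \<partial>lborel)"
    by (intro lborel_pair.Fubini') simp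
  also have "c * ((\<integral>\<^sup>+x. \<integral>\<^sup>+y. h x y \<partial>lborel \<partial>lborel) + (\<integral>\<^sup>+x. \<integral>\<^sup>+y. h x y \<partial>lborel \<partial>lborel))
      = ennreal (2 powr p) * (\<integral>\<^sup>+x. \<integral>\<^sup>+y. h x y \<partial>lborel \<partial>lborel)"
  proof -
    have "c * 2 = ennreal (2 powr p)"
      by (simp add: c_def powr_diff flip: ennreal_mult ennreal_numeral)
    then show ?thesis by (simp only: mult.assoc[symmetric] mult_2[symmetric])
  qed
  also have "(\<integral>\<^sup>+x. \<integral>\<^sup>+y. h x y \<partial>lborel \<partial>lborel)
      \<le> (\<integral>\<^sup>+x. ennreal (2 ^ DIM('a)) * ((\<integral>\<^sup>+y\<in>B. (if dist x y \<le> t then ennreal (\<bar>u x - u y\<bar> powr p) else 0) \<partial>lborel) * indicator B x) \<partial>lborel)"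
  proof (intro nn_integral_mono)
    fix x :: 'a
    \<comment> \<open>From here on \<open>y\<close> is the midpoint, and the former second endpoint is \<open>- x + 2 *\<^sub>R y\<close>.\<close>
    have "(\<integral>\<^sup>+y. h x y \<partial>lborel) = ennreal (2 ^ DIM('a)) * (\<integral>\<^sup>+y. h x (- x + 2 *\<^sub>R y) \<partial>lborel)"
      by (subst nn_integral_lborel_homothety[where c=2 and b="- x"]) auto
    also have "(\<integral>\<^sup>+y. h x (- x + 2 *\<^sub>R y) \<partial>lborel)
        \<le> (\<integral>\<^sup>+y. (if dist x y \<le> t then ennreal (\<bar>u x - u y\<bar> powr p) else 0) * indicator B y * indicator B x \<partial>lborel)"
    proof (intro nn_integral_mono)
      fix y :: 'a
      have mid: "(1/2) *\<^sub>R x + (1/2) *\<^sub>R (- x + 2 *\<^sub>R y) = y"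
        by (simp add: algebra_simps)
      have "y \<in> B" if "x \<in> B" "- x + 2 *\<^sub>R y \<in> B"
        using convexD[OF B that, of "1/2" "1/2"] unfolding mid by simp
      moreover have "dist x (- x + 2 *\<^sub>R y) = 2 * dist x y"
      proof -
        have "x - (- x + 2 *\<^sub>R y) = 2 *\<^sub>R (x - y)" by (simp add: algebra_simps scaleR_2)
        then show ?thesis by (simp add: dist_norm)
      qed
      ultimately show "h x (- x + 2 *\<^sub>R y)
          \<le> (if dist x y \<le> t then ennreal (\<bar>u x - u y\<bar> powr p) else 0) * indicator B y * indicator B x"
        unfolding h_def mid by (auto simp: indicator_def)
    qed
    also have "\<dots> = (\<integral>\<^sup>+y\<in>B. (if dist x y \<le> t then ennreal (\<bar>u x - u y\<bar> powr p) else 0) \<partial>lborel) * indicator B x"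
      by (subst nn_integral_multc) auto
    finally show "(\<integral>\<^sup>+y. h x y \<partial>lborel) \<le> ennreal (2 ^ DIM('a)) *
       ((\<integral>\<^sup>+y\<in>B. (if dist x y \<le> t then ennreal (\<bar>u x - u y\<bar> powr p) else 0) \<partial>lborel) * indicator B x)"
      by (simp add: mult_left_mono)
  qed
  also have "\<dots> = ennreal (2 ^ DIM('a)) * increment_energy p B B t u"
    unfolding increment_energy_def by (subst nn_integral_cmult) auto
  finally show ?thesis
    by (simp add: mult_left_mono powr_add powr_realpow ennreal_mult mult.assoc)
qed

lemma increment_energy_dyadic_le:
  fixes u :: "'a::euclidean_space \<Rightarrow> real" and p :: real
  assumes "u \<in> borel_measurable borel" "B \<in> sets borel" "convex B" "1 \<le> p"
  shows "increment_energy p B B t u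
    \<le> ennreal (2 powr (n * (p + DIM('a)))) * increment_energy p B B (t * 2 powr (- real n)) u"
proof (induction n)
  case (Suc n)
  define e where "e = increment_energy p B B (t * 2 powr (- real (Suc n))) u"
  have "2 * (t * 2 powr (- real (Suc n))) = t * 2 powr (- real n)"
    by (simp add: powr_diff powr_minus field_simps)
  then have "increment_energy p B B (t * 2 powr (- real n)) u \<le> ennreal (2 powr (p + DIM('a))) * e"
    using increment_energy_double_le[OF assms, of "t * 2 powr (- real (Suc n))"] by (simp only: e_def)
  then have "increment_energy p B B t u
      \<le> ennreal (2 powr (n * (p + DIM('a)))) * (ennreal (2 powr (p + DIM('a))) * e)"
    using Suc by (meson mult_left_mono order_trans zero_le)
  also have "\<dots> = ennreal (2 powr (Suc n * (p + DIM('a)))) * e"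
    by (simp add: mult.assoc[symmetric] ennreal_mult[symmetric] powr_add[symmetric] algebra_simps)
  finally show ?case by (simp add: e_def)
qed simp

section \<open>Both ranges of scales\<close>

text \<open>
  The hypothesis on \<open>A\<close> is the only property of the oscillation of \<open>u\<close> on the ball that the argument
  uses: no constant approximates \<open>u\<close> much better. Applied with the constant \<open>u y\<close> and integrated over
  \<open>y\<close> in the ball of radius \<open>R\<close>, it gives the lower bound with the volume of that ball as a factor. The length \<open>r + R\<close> is large
  enough to impose no restriction on the pairs.
\<close>
lemma ball_average_le_increments:
  fixes u :: "'a::euclidean_space \<Rightarrow> real" and A :: ennreal
  assumes [measurable]: "u \<in> borel_measurable borel" and r: "0 < r" and R: "0 < R"
    and A: "\<And>c. A \<le> ennreal (2 powr p) * (\<integral>\<^sup>+x\<in>ball x0 r. ennreal (\<bar>u x - c\<bar> powr p) \<partial>lborel)"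
  shows "ennreal (unit_ball_vol DIM('a) * R ^ DIM('a) * 2 powr (-p)) * A
    \<le> increment_energy p (ball x0 r) (ball x0 R) (r + R) u"
proof -
  define f where "f = (\<lambda>x y. if dist x y \<le> r + R then ennreal (\<bar>u x - u y\<bar> powr p) else 0)"
  have [measurable]: "case_prod f \<in> borel_measurable (lborel \<Otimes>\<^sub>M lborel)"
    unfolding f_def by measurable
  have [measurable]: "ball x0 \<rho> \<in> sets borel" for \<rho> by simp
  have A': "ennreal (2 powr (-p)) * A \<le> (\<integral>\<^sup>+x\<in>ball x0 r. ennreal (\<bar>u x - c\<bar> powr p) \<partial>lborel)" for c
  proof -
    have "ennreal (2 powr (-p)) * A \<le> ennreal (2 powr (-p)) *
        (ennreal (2 powr p) * (\<integral>\<^sup>+x\<in>ball x0 r. ennreal (\<bar>u x - c\<bar> powr p) \<partial>lborel))"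
      by (intro mult_left_mono A) auto
    then show ?thesis
      by (simp add: mult.assoc[symmetric] ennreal_mult[symmetric] powr_add[symmetric])
  qed
  have "ennreal (unit_ball_vol DIM('a) * R ^ DIM('a) * 2 powr (-p)) * A
      = (\<integral>\<^sup>+y\<in>ball x0 R. ennreal (2 powr (-p)) * A \<partial>lborel)"
    using R by (subst nn_integral_cmult_indicator) (auto simp: emeasure_ball ennreal_mult mult_ac)
  also have "\<dots> \<le> (\<integral>\<^sup>+y. (\<integral>\<^sup>+x. f x y * indicator (ball x0 r) x * indicator (ball x0 R) y \<partial>lborel) \<partial>lborel)"
  proof (intro nn_integral_mono)
    fix y
    show "ennreal (2 powr (-p)) * A * indicator (ball x0 R) y
        \<le> (\<integral>\<^sup>+x. f x y * indicator (ball x0 r) x * indicator (ball x0 R) y \<partial>lborel)"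
    proof (cases "y \<in> ball x0 R")
      case True
      have "dist x y \<le> r + R" if "x \<in> ball x0 r" for x
        using that True dist_triangle2[of x y x0] by (simp add: dist_commute)
      then have "(\<integral>\<^sup>+x\<in>ball x0 r. ennreal (\<bar>u x - u y\<bar> powr p) \<partial>lborel)
          = (\<integral>\<^sup>+x. f x y * indicator (ball x0 r) x * indicator (ball x0 R) y \<partial>lborel)"
        using True by (intro nn_integral_cong) (auto simp: f_def indicator_def)
      then show ?thesis using A'[of "u y"] True by simp
    qed simp
  qed
  also have "\<dots> = (\<integral>\<^sup>+x. (\<integral>\<^sup>+y. f x y * indicator (ball x0 r) x * indicator (ball x0 R) y \<partial>lborel) \<partial>lborel)"
    by (intro lborel_pair.Fubini') measurable
  also have "\<dots> = increment_energy p (ball x0 r) (ball x0 R) (r + R) u"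
    unfolding increment_energy_def
    by (subst nn_integral_multc[symmetric]) (auto simp: f_def mult_ac)
  finally show ?thesis .
qed

text \<open>
  At the scale \<open>2 * R\<close> with \<open>R = r * 2 ^ n\<close>, the increments from the ball of radius \<open>r\<close> to the
  concentric one of radius \<open>R\<close> are all admissible as \<open>r + R \<le> 2 * R\<close>. The volume growth \<open>R\<^sup>N\<close> cancels the
  dimensional part of the weight, and a geometric sequence with ratio \<open>2\<close> to the power
  \<open>-s * p\<close> remains.
\<close>
lemma large_scales_bound:
  fixes u :: "'a::euclidean_space \<Rightarrow> real" and A :: ennreal
  assumes u[measurable]: "u \<in> borel_measurable borel" and r: "0 < r" and s: "0 < s" "s < 1" and p: "1 \<le> p"
    and A: "\<And>c. A \<le> ennreal (2 powr p) * (\<integral>\<^sup>+x\<in>ball x0 r. ennreal (\<bar>u x - c\<bar> powr p) \<partial>lborel)"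
  shows "A \<le> ennreal (2 * (s * p) / (unit_ball_vol DIM('a) * 2 powr (- real DIM('a) - 2 * p) * r powr (- s * p))) *
    (\<integral>\<^sup>+x\<in>ball x0 r. (\<integral>\<^sup>+y. ennreal (\<bar>u x - u y\<bar> powr p / norm (x - y) powr (real DIM('a) + s * p)) \<partial>lborel) \<partial>lborel)"
proof (rule le_if_geometric_minorant)
  let ?N = "real DIM('a)"
  define k where "k = (\<lambda>n. int n + 1)"
  show "(\<Sum>n. ennreal ((r * 2 powr k n) powr (-(?N + s * p))) *
      increment_energy p (ball x0 r) UNIV (r * 2 powr k n) u)
    \<le> 2 * (\<integral>\<^sup>+x\<in>ball x0 r. (\<integral>\<^sup>+y. ennreal (\<bar>u x - u y\<bar> powr p / norm (x - y) powr (?N + s * p)) \<partial>lborel) \<partial>lborel)"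
  proof (rule suminf_increment_energy_le)
    show "1 \<le> ?N + s * p"
      using s p DIM_positive[where 'a='a] by (simp add: add_increasing2 Suc_leI)
  qed (use r in \<open>auto simp: inj_def k_def\<close>)
  fix n :: nat
  define R where "R = r * 2 ^ n"
  have R: "0 < R" "r \<le> R" using r by (auto simp: R_def)
  have t: "r * 2 powr k n = 2 * R" by (simp add: R_def k_def powr_add powr_realpow)
  have "unit_ball_vol ?N * 2 powr (- ?N - 2 * p) * r powr (- s * p) * (2 powr (-(s * p))) ^ n
     \<le> (2 * R) powr (-(?N + s * p)) * (unit_ball_vol ?N * R ^ DIM('a) * 2 powr (-p))"
  proof -
    have "(2 * R) powr (-(?N + s * p)) * R ^ DIM('a) = 2 powr (-(?N + s * p)) * R powr (-(s*p))"
      using R by (simp add: powr_mult powr_add[symmetric] flip: powr_realpow)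
    moreover have "R powr (-(s*p)) = r powr (- s * p) * (2 powr (-(s * p))) ^ n"
      using r by (simp add: R_def powr_mult powr_powr powr_power mult.commute flip: powr_realpow)
    ultimately have "(2 * R) powr (-(?N + s * p)) * (unit_ball_vol ?N * R ^ DIM('a) * 2 powr (-p))
       = unit_ball_vol ?N * (2 powr (-(?N + s * p)) * 2 powr (-p)) * r powr (- s * p) * (2 powr (-(s * p))) ^ n"
      by (simp add: mult_ac)
    moreover have "2 powr (- ?N - 2 * p) \<le> 2 powr (-(?N + s * p)) * (2::real) powr (-p)"
      unfolding powr_add[symmetric] using s p by (intro powr_mono) auto
    ultimately show ?thesis
      by (metis (no_types, lifting) mult_left_mono mult_right_mono of_nat_0_le_iff powr_ge_zero unit_ball_vol_nonneg zero_le_power)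
  qed
  then have "ennreal (unit_ball_vol ?N * 2 powr (- ?N - 2 * p) * r powr (- s * p) * (2 powr (-(s * p))) ^ n) * A
     \<le> ennreal ((2 * R) powr (-(?N + s * p))) * (ennreal (unit_ball_vol ?N * R ^ DIM('a) * 2 powr (-p)) * A)"
    using R by (simp add: mult.assoc[symmetric] ennreal_mult[symmetric] mult_right_mono ennreal_leI)
  also have "\<dots> \<le> ennreal ((2 * R) powr (-(?N + s * p))) *
      increment_energy p (ball x0 r) (ball x0 R) (r + R) u"
    by (intro mult_left_mono ball_average_le_increments u r R A) auto
  also have "\<dots> \<le> ennreal ((2 * R) powr (-(?N + s * p))) *
      increment_energy p (ball x0 r) UNIV (2 * R) u"
    unfolding increment_energy_def
    by (intro mult_left_mono nn_integral_mono mult_right_mono) (use R in \<open>auto simp: indicator_def\<close>)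
  finally show "ennreal (unit_ball_vol ?N * 2 powr (- ?N - 2 * p) * r powr (- s * p) * (2 powr (-(s * p))) ^ n) * A
    \<le> ennreal ((r * 2 powr k n) powr (-(?N + s * p))) *
      increment_energy p (ball x0 r) UNIV (r * 2 powr k n) u"
    by (simp add: t)
qed (use s p r in auto)

text \<open>
  Starting from the full ball, whose diameter is \<open>2 * r\<close>, \<open>n\<close> bisections lose \<open>n\<close> factors with
  exponent \<open>p + N\<close>, while the weight at the scale \<open>2 * r / 2 ^ n\<close> gains \<open>n\<close> factors with exponent
  \<open>N + s * p\<close>. The net loss per bisection has exponent \<open>(1 - s) * p\<close>.
\<close>
lemma small_scales_bound:
  fixes u :: "'a::euclidean_space \<Rightarrow> real" and A :: ennreal
  assumes u[measurable]: "u \<in> borel_measurable borel" and r: "0 < r" and s: "0 < s" "s < 1" and p: "1 \<le> p"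
    and A: "\<And>c. A \<le> ennreal (2 powr p) * (\<integral>\<^sup>+x\<in>ball x0 r. ennreal (\<bar>u x - c\<bar> powr p) \<partial>lborel)"
  shows "A \<le> ennreal (2 * ((1 - s) * p) / (unit_ball_vol DIM('a) * 2 powr (- real DIM('a) - 2 * p) * r powr (- s * p))) *
    (\<integral>\<^sup>+x\<in>ball x0 r. (\<integral>\<^sup>+y. ennreal (\<bar>u x - u y\<bar> powr p / norm (x - y) powr (real DIM('a) + s * p)) \<partial>lborel) \<partial>lborel)"
proof (rule le_if_geometric_minorant)
  let ?N = "real DIM('a)"
  define k where "k = (\<lambda>n. 1 - int n)"
  show "(\<Sum>n. ennreal ((r * 2 powr k n) powr (-(?N + s * p))) *
      increment_energy p (ball x0 r) UNIV (r * 2 powr k n) u)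
    \<le> 2 * (\<integral>\<^sup>+x\<in>ball x0 r. (\<integral>\<^sup>+y. ennreal (\<bar>u x - u y\<bar> powr p / norm (x - y) powr (?N + s * p)) \<partial>lborel) \<partial>lborel)"
  proof (rule suminf_increment_energy_le)
    show "1 \<le> ?N + s * p"
      using s p DIM_positive[where 'a='a] by (simp add: add_increasing2 Suc_leI)
  qed (use r in \<open>auto simp: inj_def k_def\<close>)
  fix n :: nat
  define t where "t = r * 2 powr k n"
  define v where "v = unit_ball_vol ?N * r ^ DIM('a) * 2 powr (-p)"
  have t: "t = 2 * r * 2 powr (- real n)" "t > 0"
    using r by (simp_all add: t_def k_def powr_diff powr_minus field_simps)
  have v: "0 \<le> v" using r by (simp add: v_def)
  have "unit_ball_vol ?N * 2 powr (- ?N - 2 * p) * r powr (- s * p) * (2 powr (-((1 - s) * p))) ^ n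
     \<le> t powr (-(?N + s * p)) * (2 powr (- (n * (p + ?N))) * v)"
  proof -
    have t_eq: "t powr (-(?N + s * p)) = 2 powr (-(?N + s * p)) * r powr (-(?N + s * p)) * 2 powr (n * (?N + s * p))"
    proof -
      have "- real n * (-(?N + s * p)) = n * (?N + s * p)" by (simp add: algebra_simps)
      then show ?thesis using r by (simp only: t powr_mult powr_powr)
    qed
    have r_eq: "r powr (-(?N + s * p)) * r ^ DIM('a) = r powr (- s * p)"
      using r by (simp add: powr_add[symmetric] flip: powr_realpow)
    have two_eq: "2 powr (n * (?N + s * p)) * 2 powr (- (n * (p + ?N))) = (2 powr (-((1 - s) * p))) ^ n"
      by (simp add: powr_add[symmetric] powr_power algebra_simps)
    have "t powr (-(?N + s * p)) * (2 powr (- (n * (p + ?N))) * v)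
       = unit_ball_vol ?N * (2 powr (-(?N + s * p)) * 2 powr (-p)) * (r powr (-(?N + s * p)) * r ^ DIM('a)) *
         (2 powr (n * (?N + s * p)) * 2 powr (- (n * (p + ?N))))"
      unfolding t_eq v_def by (simp only: mult_ac)
    then have "t powr (-(?N + s * p)) * (2 powr (- (n * (p + ?N))) * v)
       = unit_ball_vol ?N * (2 powr (-(?N + s * p)) * 2 powr (-p)) * r powr (- s * p) * (2 powr (-((1 - s) * p))) ^ n"
      by (simp only: r_eq two_eq)
    moreover have "2 powr (- ?N - 2 * p) \<le> 2 powr (-(?N + s * p)) * (2::real) powr (-p)"
      unfolding powr_add[symmetric] using s p by (intro powr_mono) auto
    ultimately show ?thesis
      by (metis (no_types, lifting) mult_left_mono mult_right_mono of_nat_0_le_iff powr_ge_zero unit_ball_vol_nonneg zero_le_power)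
  qed
  then have "ennreal (unit_ball_vol ?N * 2 powr (- ?N - 2 * p) * r powr (- s * p) * (2 powr (-((1 - s) * p))) ^ n) * A
     \<le> ennreal (t powr (-(?N + s * p))) * (ennreal (2 powr (- (n * (p + ?N)))) * (ennreal v * A))"
    using v by (simp add: mult.assoc[symmetric] ennreal_mult[symmetric] mult_right_mono ennreal_leI)
  also have "\<dots> \<le> ennreal (t powr (-(?N + s * p))) * increment_energy p (ball x0 r) (ball x0 r) t u"
  proof (intro mult_left_mono)
    have "ennreal v * A \<le> increment_energy p (ball x0 r) (ball x0 r) (2 * r) u"
      unfolding v_def using ball_average_le_increments[OF u r r A] by simp
    also have "\<dots> \<le> ennreal (2 powr (n * (p + ?N))) * increment_energy p (ball x0 r) (ball x0 r) t u"
      unfolding t(1) by (rule increment_energy_dyadic_le) (use p in auto)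
    finally have "ennreal (2 powr (- (n * (p + ?N)))) * (ennreal v * A) \<le> ennreal (2 powr (- (n * (p + ?N)))) *
       (ennreal (2 powr (n * (p + ?N))) * increment_energy p (ball x0 r) (ball x0 r) t u)"
      by (intro mult_left_mono) auto
    then show "ennreal (2 powr (- (n * (p + ?N)))) * (ennreal v * A) \<le> increment_energy p (ball x0 r) (ball x0 r) t u"
      by (simp add: mult.assoc[symmetric] ennreal_mult[symmetric] powr_add[symmetric])
  qed auto
  also have "\<dots> \<le> ennreal (t powr (-(?N + s * p))) * increment_energy p (ball x0 r) UNIV t u"
    by (intro mult_left_mono increment_energy_mono) auto
  finally show "ennreal (unit_ball_vol ?N * 2 powr (- ?N - 2 * p) * r powr (- s * p) * (2 powr (-((1 - s) * p))) ^ n) * A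
    \<le> ennreal ((r * 2 powr k n) powr (-(?N + s * p))) *
      increment_energy p (ball x0 r) UNIV (r * 2 powr k n) u"
    by (simp add: t_def)
qed (use s p r in auto)

section \<open>The inequality\<close>

text \<open>
  The two preceding bounds differ only by \<open>s\<close> versus \<open>1 - s\<close>, so the smaller of the two may be used;
  since the larger one is at least \<open>1 / 2\<close>, it is at most \<open>2 * s * (1 - s)\<close>.
\<close>
lemma nonlocal_poincare_ball:
  fixes u :: "'a::euclidean_space \<Rightarrow> real" and A :: ennreal
  assumes u: "u \<in> borel_measurable borel" and r: "0 < r" and s: "0 < s" "s < 1" and p: "1 \<le> p"
    and A: "\<And>c. A \<le> ennreal (2 powr p) * (\<integral>\<^sup>+x\<in>ball x0 r. ennreal (\<bar>u x - c\<bar> powr p) \<partial>lborel)"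
  shows "A \<le> ennreal (4 * p * 2 powr (real DIM('a) + 2 * p) / unit_ball_vol DIM('a) * s * (1 - s) * r powr (s * p)) *
    (\<integral>\<^sup>+x\<in>ball x0 r. (\<integral>\<^sup>+y. ennreal (\<bar>u x - u y\<bar> powr p / norm (x - y) powr (real DIM('a) + s * p)) \<partial>lborel) \<partial>lborel)"
    (is "_ \<le> ennreal ?K * ?E")
proof -
  let ?N = "real DIM('a)"
  define \<theta> where "\<theta> = min s (1 - s)"
  have "A \<le> ennreal (2 * (\<theta> * p) / (unit_ball_vol ?N * 2 powr (- ?N - 2 * p) * r powr (- s * p))) * ?E"
    using large_scales_bound[OF assms] small_scales_bound[OF assms] by (auto simp: \<theta>_def min_def)
  also have "\<dots> \<le> ennreal ?K * ?E"
  proof (intro mult_right_mono ennreal_leI)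
    have "\<theta> * 1 \<le> \<theta> * (2 * max s (1 - s))"
      using s by (intro mult_left_mono) (auto simp: \<theta>_def max_def)
    also have "\<dots> = 2 * (s * (1 - s))" by (simp add: \<theta>_def min_def max_def)
    finally have \<theta>: "\<theta> \<le> 2 * (s * (1 - s))" by simp
    have "2 * (\<theta> * p) / (unit_ball_vol ?N * 2 powr (- ?N - 2 * p) * r powr (- s * p))
        = \<theta> * (2 * p * 2 powr (?N + 2 * p) / unit_ball_vol ?N * r powr (s * p))"
    proof -
      have "- ?N - 2 * p = - (?N + 2 * p)" "- s * p = - (s * p)" by simp_all
      then show ?thesis by (simp only: powr_minus) (simp add: divide_simps)
    qed
    also have "\<dots> \<le> (2 * (s * (1 - s))) * (2 * p * 2 powr (?N + 2 * p) / unit_ball_vol ?N * r powr (s * p))"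
      using p by (intro mult_right_mono \<theta>) auto
    also have "\<dots> = ?K" by (simp add: mult_ac)
    finally show "2 * (\<theta> * p) / (unit_ball_vol ?N * 2 powr (- ?N - 2 * p) * r powr (- s * p)) \<le> ?K" .
  qed auto
  finally show ?thesis .
qed

lemma nn_integral_powr_diff_av_le:
  fixes u :: "real^'n \<Rightarrow> real"
  assumes u: "continuous_on UNIV u" and r: "0 < r" and p: "1 \<le> p"
  shows "(\<integral>\<^sup>+x\<in>ball x0 r. ennreal (\<bar>u x - av u (ball x0 r)\<bar> powr p) \<partial>lborel)
    \<le> ennreal (2 powr p) * (\<integral>\<^sup>+x\<in>ball x0 r. ennreal (\<bar>u x - c\<bar> powr p) \<partial>lborel)"
proof -
  let ?M = "restrict_space lborel (ball x0 r)"
  interpret M: finite_measure ?M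
    by (rule finite_measureI)
       (simp add: emeasure_restrict_space space_restrict_space emeasure_ball r less_imp_le)
  have "set_integrable lborel (cball x0 r) u"
    unfolding set_integrable_def by (rule borel_integrable_compact) (auto intro: continuous_on_subset[OF u])
  then have "set_integrable lborel (ball x0 r) u"
    by (rule set_integrable_subset) auto
  then have int: "integrable ?M u"
    by (simp add: integrable_restrict_space set_integrable_def)
  have vol: "measure ?M (space ?M) = measure lebesgue (ball x0 r)"
    by (simp add: space_restrict_space measure_restrict_space)
  have "(\<lambda>x. indicator (ball x0 r) x *\<^sub>R u x) \<in> borel_measurable borel"
    using u by (intro borel_measurable_scaleR borel_measurable_indicator borel_measurable_continuous_onI) auto
  then have "integral\<^sup>L ?M u = (LINT x:ball x0 r|lebesgue. u x)"
    unfolding set_lebesgue_integral_def by (subst integral_completion) (simp_all add: integral_restrict_space)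
  then have "av u (ball x0 r) = (1 / measure ?M (space ?M)) * integral\<^sup>L ?M u"
    by (simp only: av_def vol)
  moreover have "0 < measure ?M (space ?M)" using vol r by simp
  ultimately show ?thesis
    using M.nn_integral_powr_diff_mean_le[OF p int, of c]
    by (simp add: nn_integral_restrict_space)
qed

lemma ennpowr_Lp_norm:
  assumes "1 \<le> p"
  shows "ennpowr (Lp_norm p E f) p = (\<integral>\<^sup>+x\<in>E. ennreal (\<bar>f x\<bar> powr p) \<partial>lborel)"
proof -
  have "ennpowr (ennpowr a (1/p)) p = a" for a
    using assms by (cases a) (auto simp: ennpowr_def powr_powr)
  then show ?thesis by (simp add: Lp_norm_def nn_integral_completion)
qed

text \<open>
  Tonelli's theorem, using that Lebesgue measure on pairs is the completion of the product of the
  Borel measures.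
\<close>
lemma gagliardo_energy_eq_iterated:
  fixes u :: "real^'n \<Rightarrow> real"
  assumes [measurable]: "u \<in> borel_measurable borel" "S \<in> sets borel"
  shows "gagliardo_energy s p (S \<times> UNIV) u =
    (\<integral>\<^sup>+x\<in>S. (\<integral>\<^sup>+y. ennreal (\<bar>u x - u y\<bar> powr p / norm (x - y) powr (real CARD('n) + s * p)) \<partial>lborel) \<partial>lborel)"
proof -
  define f where "f = (\<lambda>z. ennreal (\<bar>u (fst z) - u (snd z)\<bar> powr p /
      norm (fst z - snd z) powr (real CARD('n) + s * p)) * indicator S (fst z))"
  have [measurable]: "f \<in> borel_measurable (lborel \<Otimes>\<^sub>M lborel)" unfolding f_def by measurable
  have "gagliardo_energy s p (S \<times> UNIV) u = (\<integral>\<^sup>+z. f z \<partial>(lborel \<Otimes>\<^sub>M lborel))"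
    unfolding gagliardo_energy_def f_def lborel_prod
    by (simp add: nn_integral_completion indicator_times)
  also have "\<dots> = (\<integral>\<^sup>+x. \<integral>\<^sup>+y. f (x, y) \<partial>lborel \<partial>lborel)"
    by (rule lborel.nn_integral_fst[symmetric]) simp
  also have "\<dots> = (\<integral>\<^sup>+x\<in>S. (\<integral>\<^sup>+y. ennreal (\<bar>u x - u y\<bar> powr p / norm (x - y) powr (real CARD('n) + s * p)) \<partial>lborel) \<partial>lborel)"
    by (simp add: f_def nn_integral_multc)
  finally show ?thesis .
qed

theorem lemma4p2:
  fixes p :: real
  assumes "1 \<le> p"
  shows "\<exists>W::real. W > 0 \<and>
    (\<forall>s::real. \<forall>x0::real^'n. \<forall>r::real. \<forall>u \<in> (smooth_compact_support :: (real^'n \<Rightarrow> real) set).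
       0 < s \<longrightarrow> s < 1 \<longrightarrow> r > 0 \<longrightarrow>
       ennpowr (Lp_norm p (ball x0 r) (\<lambda>x. u x - av u (ball x0 r))) p
         \<le> ennreal (W * s * (1 - s) * r powr (s * p)) *
           gagliardo_energy s p (ball x0 r \<times> UNIV) u)"
proof (intro exI conjI allI ballI impI)
  let ?W = "4 * p * 2 powr (real CARD('n) + 2 * p) / unit_ball_vol CARD('n)"
  show "?W > 0" using assms by simp
  fix s r :: real and x0 :: "real^'n" and u :: "real^'n \<Rightarrow> real"
  assume s: "0 < s" "s < 1" and r: "r > 0" and "u \<in> smooth_compact_support"
  then have "C_diff 0 u" unfolding smooth_compact_support_def by blast
  then have cont: "continuous_on UNIV u" by simp
  then have u: "u \<in> borel_measurable borel" by (rule borel_measurable_continuous_onI)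
  show "ennpowr (Lp_norm p (ball x0 r) (\<lambda>x. u x - av u (ball x0 r))) p
      \<le> ennreal (?W * s * (1 - s) * r powr (s * p)) * gagliardo_energy s p (ball x0 r \<times> UNIV) u"
    using nonlocal_poincare_ball[OF u r s assms nn_integral_powr_diff_av_le[OF cont r assms]]
    by (simp add: ennpowr_Lp_norm[OF assms] gagliardo_energy_eq_iterated[OF u])
qed

end
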